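(* Let $k\ge 2$ be an even integer and let $G$ be any graph of order $n$, size $m$ and maximum degree $\Delta(G)\le k$. If no (connected) component of $G$ is $k$-regular, then $$\alpha'(G) \ge \left(\frac{k+2}{k^2+k+2}\right) m - \left(\frac{k-2}{k^2+k+2}\right) n.$$
   Context: Graphs are finite, simple and undirected (not necessarily connected). The order of a graph is its number of vertices and the size is its number of edges. The matching number $\alpha'(G)$ is the maximum number of edges in a matching of $G$. *)

theory Defs
  imports Complex_Main
begin

text \<open>A finite simple undirected graph is given by its vertex set \<open>V\<close> and its edge set \<open>E\<close>,
  each edge being the two-element set of its endpoints.\<close>

definition simple_graph :: "'a set \<Rightarrow> 'a set set \<Rightarrow> bool" where
  "simple_graph V E \<longleftrightarrow> finite V \<and> (\<forall>e\<in>E. e \<subseteq> V \<and> card e = 2)"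

definition vertex_degree :: "'a set set \<Rightarrow> 'a \<Rightarrow> nat" where
  "vertex_degree E v = card {e \<in> E. v \<in> e}"

text \<open>Inserting 0 changes the maximum only for the graph without vertices.\<close>

definition max_degree :: "'a set \<Rightarrow> 'a set set \<Rightarrow> nat" where
  "max_degree V E = Max (insert 0 (vertex_degree E ` V))"

definition regular_graph :: "nat \<Rightarrow> 'a set \<Rightarrow> 'a set set \<Rightarrow> bool" where
  "regular_graph k V E \<longleftrightarrow> (\<forall>v\<in>V. vertex_degree E v = k)"

definition adjacency :: "'a set set \<Rightarrow> ('a \<times> 'a) set" where
  "adjacency E = {(u, v). {u, v} \<in> E}"

text \<open>Components are represented by their vertex sets; the component itself is the subgraph
  induced by such a set.\<close>

definition components :: "'a set \<Rightarrow> 'a set set \<Rightarrow> 'a set set" where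
  "components V E = {{u \<in> V. (v, u) \<in> (adjacency E)\<^sup>*} | v. v \<in> V}"

definition induced_edges :: "'a set set \<Rightarrow> 'a set \<Rightarrow> 'a set set" where
  "induced_edges E C = {e \<in> E. e \<subseteq> C}"

definition matching :: "'a set set \<Rightarrow> 'a set set \<Rightarrow> bool" where
  "matching E M \<longleftrightarrow> M \<subseteq> E \<and> (\<forall>e\<in>M. \<forall>f\<in>M. e \<noteq> f \<longrightarrow> e \<inter> f = {})"

definition matching_number :: "'a set set \<Rightarrow> nat" where
  "matching_number E = Max {card M | M. matching E M}"

end

theory Submission
  imports Defs "HOL-Library.Disjoint_Sets"
begin

text \<open>By Edmonds' odd set cover theorem there are a matching \<open>M\<close>, a vertex set \<open>S\<close> and disjoint blocks
  outside \<open>S\<close> such that every edge meets \<open>S\<close> or lies inside a block, and \<open>M\<close> has at least \<open>|S|\<close>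
  plus the sum of all \<open>\<lfloor>|B|/2\<rfloor>\<close> edges. Since \<open>(k\<^sup>2 + k + 2) + (k - 2) = (k + 2) k\<close>, each vertex of \<open>S\<close>
  pays for the at most \<open>k\<close> edges at it. A block pays for its own edges by a degree sum: inside \<open>B\<close>
  degrees are at most \<open>min k (|B| - 1)\<close>, and not all of them equal \<open>k\<close>, because a block that induces a
  \<open>k\<close>-regular graph would contain a \<open>k\<close>-regular component.\<close>

section \<open>Matchings of maximum size\<close>

definition maximum_matching :: "'a set set \<Rightarrow> 'a set set \<Rightarrow> bool" where
  "maximum_matching E M \<longleftrightarrow> matching E M \<and> (\<forall>N. matching E N \<longrightarrow> card N \<le> card M)"

lemma simple_graph_finite_edges:
  assumes "simple_graph V E"
  shows "finite E"
proof -
  have "E \<subseteq> Pow V" "finite V" using assms by (auto simp: simple_graph_def)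
  then show ?thesis by (meson finite_Pow_iff finite_subset)
qed

lemma matching_subset: "matching E M \<Longrightarrow> M \<subseteq> E"
  by (simp add: matching_def)

lemma finite_matching: "simple_graph V E \<Longrightarrow> matching E M \<Longrightarrow> finite M"
  using simple_graph_finite_edges finite_subset matching_subset by metis

lemma maximum_matching_exists:
  assumes "simple_graph V E"
  obtains M where "maximum_matching E M"
proof -
  have "finite {M. matching E M}"
    using simple_graph_finite_edges[OF assms] matching_subset
    by (metis (mono_tags, lifting) Collect_mono Pow_def finite_Pow_iff finite_subset)
  moreover have "matching E {}" by (simp add: matching_def)
  ultimately obtain M where "matching E M" "\<And>N. matching E N \<Longrightarrow> card N \<le> card M"
    using Max_ge[of "card ` {M. matching E M}"] Max_in[of "card ` {M. matching E M}"]
    by (smt (verit) empty_iff finite_imageI imageE image_eqI mem_Collect_eq)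
  then show thesis using that by (auto simp: maximum_matching_def)
qed

lemma matching_number_ge:
  assumes "simple_graph V E" "matching E M"
  shows "card M \<le> matching_number E"
proof -
  have "finite {M. matching E M}"
    using simple_graph_finite_edges[OF assms(1)] matching_subset
    by (metis (mono_tags, lifting) Collect_mono Pow_def finite_Pow_iff finite_subset)
  then have "finite {card M | M. matching E M}"
    by (auto simp: setcompr_eq_image)
  then show ?thesis
    unfolding matching_number_def using assms(2) by (intro Max_ge) auto
qed

lemma card_Union_matching:
  assumes "simple_graph V E" "matching E M"
  shows "card (\<Union>M) = 2 * card M"
proof -
  have c: "card e = 2" "finite e" if "e \<in> M" for e
    using assms that by (auto simp: simple_graph_def matching_def intro: finite_subset)
  have "pairwise disjnt M"
    using assms(2) by (auto simp: pairwise_def disjnt_def matching_def)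
  then have "card (\<Union>M) = sum card M"
    by (intro card_Union_disjoint) (use c in auto)
  also have "\<dots> = sum (\<lambda>_. 2) M" by (rule sum.cong) (use c in auto)
  finally show ?thesis by simp
qed

lemma edge_other_end:
  assumes "simple_graph V E" "e \<in> E" "x \<in> e"
  obtains y where "e = {x, y}" "y \<noteq> x"
proof -
  have "card e = 2" using assms by (auto simp: simple_graph_def)
  then obtain a b where "e = {a, b}" "a \<noteq> b" by (meson card_2_iff)
  then show thesis using that assms(3) by (cases "x = a") auto
qed

lemma matching_insert:
  assumes "matching E M" "e \<in> E" "e \<inter> \<Union>M = {}"
  shows "matching E (insert e M)"
proof -
  have "e \<inter> f = {}" "f \<inter> e = {}" if "f \<in> M" for f using assms(3) that by blast+
  then show ?thesis using assms(1,2) by (simp add: matching_def)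
qed

section \<open>Inseparable vertices and Gallai's lemma\<close>

text \<open>Two distinct vertices are related when no maximum matching misses both. Equality is
  added by hand to get reflexivity, since the classes of this relation are to become the
  blocks.\<close>

definition inseparable :: "'a set set \<Rightarrow> 'a \<Rightarrow> 'a \<Rightarrow> bool" where
  "inseparable E u v \<longleftrightarrow> u = v \<or> (\<forall>M. maximum_matching E M \<longrightarrow> u \<in> \<Union>M \<or> v \<in> \<Union>M)"

lemma inseparable_sym: "inseparable E u v \<Longrightarrow> inseparable E v u"
  by (auto simp: inseparable_def)

text \<open>A maximum matching that missed both ends could be enlarged by the edge itself. Hence,
  once the relation is an equivalence, every edge stays within one class.\<close>

lemma inseparable_edge:
  assumes G: "simple_graph V E" and e: "{u, v} \<in> E"
  shows "inseparable E u v"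
proof (rule ccontr)
  assume "\<not> inseparable E u v"
  then obtain M where M: "maximum_matching E M" "u \<notin> \<Union>M" "v \<notin> \<Union>M"
    by (auto simp: inseparable_def)
  then have mM: "matching E M" by (simp add: maximum_matching_def)
  have "matching E (insert {u, v} M)"
    using M e mM by (intro matching_insert) auto
  moreover have "card (insert {u, v} M) = Suc (card M)"
    using finite_matching[OF G mM] M by (subst card_insert_disjoint) auto
  ultimately show False using M(1) by (auto simp: maximum_matching_def)
qed

text \<open>Dropping \<open>{y, z}\<close> frees \<open>y\<close>, and \<open>x\<close> was free
  already, so \<open>{x, y}\<close> can take its place without changing the size. This is the only
  move needed to bring one maximum matching closer to another.\<close>

lemma exchange_matching:
  assumes G: "simple_graph V E" and N: "maximum_matching E N"
    and xy: "{x, y} \<in> E" and x: "x \<notin> \<Union>N" and yz: "{y, z} \<in> N"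
  shows "maximum_matching E (insert {x, y} (N - {{y, z}}))"
proof -
  have mN: "matching E N" using N by (simp add: maximum_matching_def)
  have "matching E (N - {{y, z}})" using mN by (auto simp: matching_def)
  moreover have "y \<notin> \<Union>(N - {{y, z}})" using mN yz by (fastforce simp: matching_def)
  ultimately have "matching E (insert {x, y} (N - {{y, z}}))"
    using xy x by (intro matching_insert) auto
  moreover have "card (insert {x, y} (N - {{y, z}})) = card N"
    using finite_matching[OF G mN] x yz
    by (metis DiffD1 UnionI card_Suc_Diff1 card_insert_disjoint finite_Diff insertI1)
  ultimately show ?thesis using N by (simp add: maximum_matching_def)
qed

text \<open>Gallai's lemma without alternating paths: among the maximum matchings \<open>N\<close> that miss \<open>t\<close>, one that
  shares as many edges as possible with \<open>M\<close> could still be exchanged towards \<open>M\<close>.\<close>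

lemma inseparable_trans:
  assumes G: "simple_graph V E"
    and missed: "maximum_matching E N0" "t \<notin> \<Union>N0"
    and ut: "inseparable E u t" and tv: "inseparable E t v"
  shows "inseparable E u v"
proof (rule ccontr)
  assume "\<not> inseparable E u v"
  then obtain M where M: "maximum_matching E M" "u \<notin> \<Union>M" "v \<notin> \<Union>M" and "u \<noteq> v"
    by (auto simp: inseparable_def)
  have "t \<noteq> u" "t \<noteq> v" using ut tv \<open>\<not> inseparable E u v\<close> by auto
  have tM: "t \<in> \<Union>M" using ut M \<open>t \<noteq> u\<close> by (auto simp: inseparable_def)
  have mM: "matching E M" using M by (simp add: maximum_matching_def)
  have finM: "finite M" by (rule finite_matching[OF G mM])
  define P where "P N \<longleftrightarrow> maximum_matching E N \<and> t \<notin> \<Union>N" for N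
  have "\<forall>N. P N \<longrightarrow> card (M \<inter> N) < Suc (card M)"
    using finM by (simp add: card_mono le_imp_less_Suc)
  then obtain N where N: "P N" and Nmax: "\<And>N'. P N' \<Longrightarrow> card (M \<inter> N') \<le> card (M \<inter> N)"
    using ex_has_greatest_nat[of P N0 "\<lambda>N. card (M \<inter> N)" "Suc (card M)"] missed
    unfolding P_def by metis
  have maxN: "maximum_matching E N" and tN: "t \<notin> \<Union>N" using N by (auto simp: P_def)
  have mN: "matching E N" using maxN by (simp add: maximum_matching_def)
  have uN: "u \<in> \<Union>N" "v \<in> \<Union>N"
    using ut tv maxN tN \<open>t \<noteq> u\<close> \<open>t \<noteq> v\<close> by (auto simp: inseparable_def)
  have "card M = card N"
    using M(1) maxN by (simp add: maximum_matching_def le_antisym)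
  then have cardeq: "card (\<Union>M) = card (\<Union>N)"
    using card_Union_matching[OF G] mM mN by simp
  have "\<Union>M \<subseteq> V" "\<Union>N \<subseteq> V" "finite V"
    using G mM mN by (auto simp: simple_graph_def matching_def)
  then have fin: "finite (\<Union>M)" "finite (\<Union>N)" by (auto intro: finite_subset)
  \<comment> \<open>\<open>M\<close> and \<open>N\<close> cover equally many vertices, and
    \<open>N\<close> covers both \<open>u\<close> and \<open>v\<close>, which \<open>M\<close>
    misses. So \<open>M\<close> covers at least two vertices that \<open>N\<close> misses, and one
    of them differs from \<open>t\<close>.\<close>
  have "card (\<Union>M - \<Union>N) = card (\<Union>N - \<Union>M)"
    using cardeq fin by (metis card_Diff_subset_Int finite_Int Int_commute)
  moreover have "card {u, v} \<le> card (\<Union>N - \<Union>M)"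
    using fin uN M by (intro card_mono) auto
  ultimately have "\<not> \<Union>M - \<Union>N \<subseteq> {t}"
    using \<open>u \<noteq> v\<close> card_mono[of "{t}" "\<Union>M - \<Union>N"] by auto
  then obtain x where x: "x \<in> \<Union>M" "x \<notin> \<Union>N" "x \<noteq> t" by blast
  then obtain e where e: "e \<in> M" "x \<in> e" by blast
  then have eE: "e \<in> E" using mM matching_subset by blast
  obtain y where y: "e = {x, y}" "y \<noteq> x" by (rule edge_other_end[OF G eE e(2)])
  have "y \<in> \<Union>N"
  proof (rule ccontr)
    assume "y \<notin> \<Union>N"
    moreover have "inseparable E x y" using inseparable_edge[OF G] eE y by simp
    ultimately show False using x y maxN by (auto simp: inseparable_def)
  qed
  then obtain f where f: "f \<in> N" "y \<in> f" by blast
  then have fE: "f \<in> E" using mN matching_subset by blast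
  obtain z where z: "f = {y, z}" "z \<noteq> y" by (rule edge_other_end[OF G fE f(2)])
  \<comment> \<open>The exchange gains \<open>e\<close>, an edge of \<open>M\<close>, and loses
    \<open>f\<close>, which is not in \<open>M\<close> because it meets \<open>e\<close> in
    \<open>y\<close> and differs from it. The vertex \<open>t\<close> stays missed: it differs from
    \<open>x\<close>, and \<open>y\<close> is covered by \<open>N\<close>. So \<open>N'\<close>
    contradicts the choice of \<open>N\<close>.\<close>
  define N' where "N' = insert {x, y} (N - {{y, z}})"
  have "maximum_matching E N'"
    unfolding N'_def using exchange_matching[OF G maxN] eE y x f z by blast
  moreover have "t \<notin> \<Union>N'" using x tN f unfolding N'_def by auto
  ultimately have "card (M \<inter> N') \<le> card (M \<inter> N)" using Nmax by (simp add: P_def)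
  moreover have "f \<notin> M"
  proof
    assume "f \<in> M"
    moreover have "e \<inter> f \<noteq> {}" using f y by blast
    ultimately have "f = e" using mM e unfolding matching_def by blast
    then show False using e f x by blast
  qed
  then have "M \<inter> N' = insert e (M \<inter> N)" using e y z f unfolding N'_def by auto
  moreover have "e \<notin> N" using e x by blast
  ultimately show False using finM by simp
qed

section \<open>The odd set cover\<close>

text \<open>The covering form of the Tutte-Berge formula. A vertex that lies in every maximum matching is moved
  to \<open>S\<close>; if there is none, the blocks are the classes of the relation \<open>inseparable\<close>, and a maximum
  matching misses at most one vertex of each class.\<close>

lemma odd_set_cover:
  assumes "simple_graph V E"
  shows "\<exists>M S P. matching E M \<and> S \<subseteq> V \<and> \<Union>P \<subseteq> V - S \<and> disjoint P
    \<and> (\<forall>e\<in>E. e \<inter> S \<noteq> {} \<or> (\<exists>B\<in>P. e \<subseteq> B))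
    \<and> card S + (\<Sum>B\<in>P. card B div 2) \<le> card M"
  using assms
proof (induction "card V" arbitrary: V E rule: less_induct)
  case less
  note G = \<open>simple_graph V E\<close>
  have finV: "finite V" using G by (simp add: simple_graph_def)
  show ?case
  proof (cases "\<exists>v\<in>V. \<forall>M. maximum_matching E M \<longrightarrow> v \<in> \<Union>M")
    case True
    then obtain v where v: "v \<in> V" "\<And>M. maximum_matching E M \<Longrightarrow> v \<in> \<Union>M" by blast
    define E' where "E' = {e \<in> E. v \<notin> e}"
    have "card (V - {v}) < card V" using v finV by (intro card_Diff1_less)
    moreover have "simple_graph (V - {v}) E'"
      using G by (auto simp: simple_graph_def E'_def)
    ultimately obtain M' S P where IH: "matching E' M'" "S \<subseteq> V - {v}"
      "\<Union>P \<subseteq> V - {v} - S" "disjoint P"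
      "\<And>e. e \<in> E' \<Longrightarrow> e \<inter> S \<noteq> {} \<or> (\<exists>B\<in>P. e \<subseteq> B)"
      "card S + (\<Sum>B\<in>P. card B div 2) \<le> card M'"
      using less.hyps by metis
    have mM': "matching E M'" and "v \<notin> \<Union>M'"
      using IH(1) by (auto simp: matching_def E'_def)
    \<comment> \<open>\<open>M'\<close> misses \<open>v\<close>, which every maximum matching
      covers. A matching larger than \<open>M'\<close> therefore exists, and its additional edge
      pays for adding \<open>v\<close> to \<open>S\<close>.\<close>
    then have "\<not> maximum_matching E M'" using v by blast
    then obtain M where M: "matching E M" "card M' < card M"
      using mM' by (auto simp: maximum_matching_def not_le)
    have "finite S" "v \<notin> S" using IH(2) finV by (auto intro: finite_subset)
    then have "card (insert v S) + (\<Sum>B\<in>P. card B div 2) \<le> card M"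
      using IH(6) M(2) by simp
    moreover have "e \<inter> insert v S \<noteq> {} \<or> (\<exists>B\<in>P. e \<subseteq> B)" if "e \<in> E" for e
      using IH(5)[of e] that by (auto simp: E'_def)
    moreover have "insert v S \<subseteq> V" "\<Union>P \<subseteq> V - insert v S" using IH v by auto
    ultimately show ?thesis using M(1) IH(4) by blast
  next
    case False
    then have missed: "\<exists>M. maximum_matching E M \<and> v \<notin> \<Union>M" if "v \<in> V" for v
      using that by blast
    define R where "R = {(u, v). u \<in> V \<and> v \<in> V \<and> inseparable E u v}"
    have eq: "equiv V R"
    proof (rule equivI)
      show "R \<subseteq> V \<times> V" by (auto simp: R_def)
      show "refl_on V R" by (auto simp: refl_on_def R_def inseparable_def)
      show "sym R" by (auto simp: sym_def R_def intro: inseparable_sym)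
      \<comment> \<open>Gallai's lemma needs a maximum matching that misses the middle vertex; in
        this case every vertex has one.\<close>
      show "trans R" unfolding trans_def R_def using inseparable_trans[OF G] missed by blast
    qed
    define P where "P = V // R"
    obtain M where maxM: "maximum_matching E M" using maximum_matching_exists[OF G] .
    then have mM: "matching E M" by (simp add: maximum_matching_def)
    have finM: "finite M" by (rule finite_matching[OF G mM])
    have UP: "\<Union>P = V" unfolding P_def using eq by (rule Union_quotient)
    have finP: "finite P" unfolding P_def using finV eq
      by (simp add: equiv_type finite_quotient)
    have disj: "disjoint P"
      unfolding P_def disjoint_def using quotient_disj[OF eq] by blast
    have inside: "\<exists>B\<in>P. e \<subseteq> B" if "e \<in> E" for e
    proof -
      have "card e = 2" "e \<subseteq> V" using that G by (auto simp: simple_graph_def)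
      then obtain a b where ab: "e = {a, b}" "a \<in> V" "b \<in> V" by (auto simp: card_2_iff)
      then have "(a, b) \<in> R" using inseparable_edge[OF G] that by (auto simp: R_def)
      then have "e \<subseteq> R `` {a}" using ab eq by (auto simp: equiv_def refl_on_def)
      then show ?thesis using ab by (auto simp: P_def intro: quotientI)
    qed
    have block: "card B div 2 \<le> card {e \<in> M. e \<subseteq> B}" if "B \<in> P" for B
    proof -
      let ?MB = "{e \<in> M. e \<subseteq> B}"
      have finB: "finite B" using that UP finV by (meson Sup_upper finite_subset)
      \<comment> \<open>Edges of \<open>M\<close> lie inside single blocks, so a vertex of
        \<open>B\<close> not covered by \<open>?MB\<close> is missed by all of \<open>M\<close>. Two
        such vertices are inseparable and hence equal. Rounding \<open>card B div 2\<close> down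
        absorbs the one that may be left over.\<close>
      have "card (B - \<Union>?MB) \<le> 1"
      proof -
        have "a = b" if ab: "a \<in> B - \<Union>?MB" "b \<in> B - \<Union>?MB" for a b
        proof -
          have unc: "c \<notin> \<Union>M" if c: "c \<in> B - \<Union>?MB" for c
          proof
            assume "c \<in> \<Union>M"
            then obtain e where e: "e \<in> M" "c \<in> e" by blast
            then obtain B' where B': "B' \<in> P" "e \<subseteq> B'"
              using inside mM matching_subset by blast
            have "B' = B"
              using disj B' \<open>B \<in> P\<close> c e unfolding disjoint_def by blast
            then show False using c e B' by blast
          qed
          have "(a, b) \<in> R"
            using quotient_eq_iff[OF eq, of B B a b] \<open>B \<in> P\<close> ab unfolding P_def by blast
          then show ?thesis using unc[OF ab(1)] unc[OF ab(2)] maxM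
            by (auto simp: R_def inseparable_def)
        qed
        then show ?thesis using finB by (simp add: card_le_Suc0_iff_eq)
      qed
      moreover have "matching E ?MB" using mM by (auto simp: matching_def)
      then have "card (\<Union>?MB) = 2 * card ?MB" by (rule card_Union_matching[OF G])
      moreover have "card B \<le> card (\<Union>?MB) + card (B - \<Union>?MB)"
      proof -
        have "B = \<Union>?MB \<union> (B - \<Union>?MB)" by auto
        then show ?thesis by (metis card_Un_le)
      qed
      ultimately show ?thesis by linarith
    qed
    have "(\<Sum>B\<in>P. card B div 2) \<le> (\<Sum>B\<in>P. card {e \<in> M. e \<subseteq> B})"
      by (rule sum_mono) (rule block)
    also have "\<dots> = card (\<Union>B\<in>P. {e \<in> M. e \<subseteq> B})"
    proof (rule card_UN_disjoint[symmetric])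
      \<comment> \<open>An empty edge would lie in every block; a nonempty one lies in at most one
        of the disjoint blocks.\<close>
      have "e \<noteq> {}" if "e \<in> M" for e
        using that mM G by (fastforce simp: matching_def simple_graph_def)
      then show "\<forall>i\<in>P. \<forall>j\<in>P. i \<noteq> j \<longrightarrow> {e \<in> M. e \<subseteq> i} \<inter> {e \<in> M. e \<subseteq> j} = {}"
        using disj unfolding disjoint_def by blast
    qed (use finP finM in auto)
    also have "\<dots> \<le> card M" using finM by (intro card_mono) auto
    finally show ?thesis
      using mM disj inside UP by (intro exI[of _ M] exI[of _ "{}"] exI[of _ P]) simp
  qed
qed

section \<open>Degree sums and regular components\<close>

lemma sum_vertex_degree:
  assumes "finite B" "finite F" "\<And>e. e \<in> F \<Longrightarrow> e \<subseteq> B \<and> card e = 2"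
  shows "(\<Sum>v\<in>B. vertex_degree F v) = 2 * card F"
proof -
  have "(\<Sum>v\<in>B. vertex_degree F v) = (\<Sum>v\<in>B. \<Sum>e\<in>F. if v \<in> e then 1 else 0)"
    using assms(2) by (simp add: vertex_degree_def sum.If_cases Int_def)
  also have "\<dots> = (\<Sum>e\<in>F. \<Sum>v\<in>B. if v \<in> e then 1 else 0)" by (rule sum.swap)
  also have "\<dots> = (\<Sum>e\<in>F. 2)"
  proof (rule sum.cong[OF refl])
    fix e assume "e \<in> F"
    then have "card {v \<in> B. v \<in> e} = 2"
      using assms(3)[of e] by (metis Int_absorb1 Int_def)
    then show "(\<Sum>v\<in>B. if v \<in> e then 1 else 0) = (2::nat)"
      using assms(1) by (simp add: sum.If_cases Int_def)
  qed
  finally show ?thesis by simp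
qed

lemma vertex_degree_less_card:
  assumes "finite B" "v \<in> B" "\<And>e. e \<in> F \<Longrightarrow> e \<subseteq> B \<and> card e = 2"
  shows "vertex_degree F v < card B"
proof -
  have "{e \<in> F. v \<in> e} \<subseteq> (\<lambda>w. {v, w}) ` (B - {v})"
  proof
    fix e assume e: "e \<in> {e \<in> F. v \<in> e}"
    then have "card e = 2" using assms(3) by simp
    then obtain a b where "e = {a, b}" "a \<noteq> b" by (auto simp: card_2_iff)
    then show "e \<in> (\<lambda>w. {v, w}) ` (B - {v})" using e assms(3)[of e] by auto
  qed
  then have "vertex_degree F v \<le> card (B - {v})"
    unfolding vertex_degree_def using assms(1) surj_card_le by blast
  also have "\<dots> < card B" using assms(1,2) by (rule card_Diff1_less)
  finally show ?thesis .
qed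

text \<open>A vertex with \<open>k\<close> edges inside \<open>B\<close> has no further edges, as
  its degree in \<open>E\<close> is at most \<open>k\<close>. So no edge leaves \<open>B\<close>,
  the component of \<open>v\<close> stays inside \<open>B\<close>, and its vertices keep all their
  \<open>k\<close> edges within it.\<close>

lemma component_of_saturated_set:
  assumes G: "simple_graph V E" and "v \<in> B" "B \<subseteq> V"
    and deg: "\<And>u. u \<in> V \<Longrightarrow> vertex_degree E u \<le> k"
    and reg: "regular_graph k B (induced_edges E B)"
  shows "\<exists>C\<in>components V E. regular_graph k C (induced_edges E C)"
proof -
  define C where "C = {u \<in> V. (v, u) \<in> (adjacency E)\<^sup>*}"
  have finE: "finite E" by (rule simple_graph_finite_edges[OF G])
  have same: "{e \<in> induced_edges E B. u \<in> e} = {e \<in> E. u \<in> e}"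
    and full: "vertex_degree E u = k" if "u \<in> B" for u
  proof -
    have "k = card {e \<in> induced_edges E B. u \<in> e}"
      using reg that by (simp add: regular_graph_def vertex_degree_def)
    moreover have "card {e \<in> E. u \<in> e} \<le> k"
      using deg[of u] that \<open>B \<subseteq> V\<close> by (auto simp: vertex_degree_def)
    ultimately show eq: "{e \<in> induced_edges E B. u \<in> e} = {e \<in> E. u \<in> e}"
      using finE by (intro card_seteq) (auto simp: induced_edges_def)
    show "vertex_degree E u = k"
      using reg that by (simp add: regular_graph_def vertex_degree_def flip: eq)
  qed
  have "u \<in> B" if "(v, u) \<in> (adjacency E)\<^sup>*" for u
    using that
  proof (induction rule: rtrancl_induct)
    case base
    show ?case by fact
  next
    case (step y z)
    then have "{y, z} \<in> {e \<in> induced_edges E B. y \<in> e}"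
      using same[of y] by (auto simp: adjacency_def)
    then show ?case by (auto simp: induced_edges_def)
  qed
  then have CB: "C \<subseteq> B" by (auto simp: C_def)
  have "e \<subseteq> C" if e: "e \<in> E" "u \<in> e" and "u \<in> C" for e u
  proof -
    obtain w where "e = {u, w}" by (rule edge_other_end[OF G e])
    moreover have "(v, u) \<in> (adjacency E)\<^sup>*" using that by (simp add: C_def)
    moreover have "e \<subseteq> V" using G that by (auto simp: simple_graph_def)
    ultimately show ?thesis
      using that by (auto simp: C_def adjacency_def intro: rtrancl_into_rtrancl)
  qed
  then have "{e \<in> induced_edges E C. u \<in> e} = {e \<in> E. u \<in> e}" if "u \<in> C" for u
    using that by (auto simp: induced_edges_def)
  then have "regular_graph k C (induced_edges E C)"
    using full CB by (auto simp: regular_graph_def vertex_degree_def)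
  moreover have "C \<in> components V E"
    unfolding components_def C_def using \<open>v \<in> B\<close> \<open>B \<subseteq> V\<close> by blast
  ultimately show ?thesis by blast
qed

section \<open>The inequality for one block\<close>

text \<open>Here \<open>b\<close> counts the vertices and \<open>c\<close> the edges of a block. For
  even \<open>b\<close> the degree bound \<open>k\<close> suffices, for odd \<open>b \<le> k\<close>
  the bound by the complete graph, and for odd \<open>b > k\<close> the strict degree bound is
  required.\<close>

lemma block_bound:
  fixes k b c :: int
  assumes "k \<ge> 2" "even k" "b \<ge> 0" "2 * c \<le> k * b" "2 * c \<le> b * (b - 1)"
    and "odd b \<Longrightarrow> 2 * c < k * b"
  shows "(k + 2) * c \<le> (k\<^sup>2 + k + 2) * (b div 2) + (k - 2) * b"
proof (cases "even b")
  case True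
  then obtain a where b: "b = 2 * a" by blast
  then have "c \<le> k * a" using assms(4) by simp
  then have "(k + 2) * c \<le> (k + 2) * (k * a)" using assms(1) by (intro mult_left_mono) auto
  \<comment> \<open>This is exactly the claimed right side minus
    \<open>(k + 2) * (k * a)\<close>.\<close>
  moreover have "0 \<le> (k - 2) * a" using assms(1,3) b by simp
  ultimately show ?thesis using b by (simp add: algebra_simps power2_eq_square)
next
  case False
  then obtain a where b: "b = 2 * a + 1" by (metis oddE)
  have div: "b div 2 = a" and "a \<ge> 0" using b assms(3) by auto
  obtain h where h: "k = 2 * h" using assms(2) by blast
  show ?thesis
  proof (cases "b \<le> k")
    case True
    \<comment> \<open>Since \<open>b\<close> is odd and \<open>k\<close> even,
      \<open>b \<le> k\<close> sharpens to \<open>b \<le> k - 1\<close>. The complete graph bound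
      then suffices because \<open>(k + 2) * (k - 1) = k\<^sup>2 + k - 2\<close>.\<close>
    then have "a \<le> h - 1" using b h by simp
    have "c \<le> (2 * a + 1) * a" using assms(5) b by (simp add: algebra_simps)
    then have "(k + 2) * c \<le> (k + 2) * ((2 * a + 1) * a)"
      using assms(1) by (intro mult_left_mono) auto
    also have "\<dots> \<le> (k + 2) * ((k - 1) * a)"
      using \<open>a \<le> h - 1\<close> h \<open>a \<ge> 0\<close> assms(1) by (intro mult_left_mono mult_right_mono) auto
    also have "\<dots> \<le> (k\<^sup>2 + k + 2) * a"
      using \<open>a \<ge> 0\<close> by (simp add: algebra_simps power2_eq_square)
    also have "\<dots> \<le> (k\<^sup>2 + k + 2) * a + (k - 2) * b" using assms(1,3) by simp
    finally show ?thesis using div by simp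
  next
    case False
    then have "a \<ge> h" using b h by simp
    have "c < h * b" using assms(6) \<open>odd b\<close> h by simp
    txt \<open>The parity of \<open>k\<close> enters here: \<open>2 c < k b\<close> improves to \<open>2 c \<le> k b - 2\<close>.\<close>
    then have "c \<le> h * b - 1" by simp
    then have "(k + 2) * c \<le> (k + 2) * (h * b - 1)" using assms(1) by (intro mult_left_mono) auto
    \<comment> \<open>The claimed right side minus \<open>(k + 2) * (h * b - 1)\<close> is twice
      this product. It vanishes at \<open>a = h\<close>, that is, at
      \<open>b = k + 1\<close>.\<close>
    moreover have "0 \<le> (h - 1) * (a - h)" using \<open>a \<ge> h\<close> h assms(1) by simp
    ultimately show ?thesis
      unfolding div unfolding b h by (simp add: algebra_simps power2_eq_square)
  qed
qed

text \<open>The degree sum inside \<open>B\<close> supplies the three bounds for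
  \<open>block_bound\<close>: degrees are at most \<open>k\<close>, at most
  \<open>card B - 1\<close>, and not all equal to \<open>k\<close> when \<open>card B\<close> is
  odd. The empty set is vacuously regular, so \<open>reg\<close> speaks of nonempty \<open>B\<close>
  only.\<close>

lemma induced_edges_bound:
  assumes "k \<ge> 2" "even k" and G: "simple_graph V E" and "B \<subseteq> V"
    and deg: "\<And>u. u \<in> V \<Longrightarrow> vertex_degree E u \<le> k"
    and reg: "B \<noteq> {} \<Longrightarrow> \<not> regular_graph k B (induced_edges E B)"
  shows "(k + 2) * card (induced_edges E B) \<le> (k\<^sup>2 + k + 2) * (card B div 2) + (k - 2) * card B"
proof -
  let ?F = "induced_edges E B"
  have finB: "finite B" using G \<open>B \<subseteq> V\<close> by (auto simp: simple_graph_def intro: finite_subset)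
  have finE: "finite E" by (rule simple_graph_finite_edges[OF G])
  then have finF: "finite ?F" by (simp add: induced_edges_def)
  have F: "e \<subseteq> B \<and> card e = 2" if "e \<in> ?F" for e
    using that G by (auto simp: simple_graph_def induced_edges_def)
  have sum: "(\<Sum>v\<in>B. vertex_degree ?F v) = 2 * card ?F"
    using finB finF F by (rule sum_vertex_degree)
  have degF: "vertex_degree ?F v \<le> k" if "v \<in> B" for v
  proof -
    have "vertex_degree ?F v \<le> vertex_degree E v"
      unfolding vertex_degree_def using finE by (intro card_mono) (auto simp: induced_edges_def)
    then show ?thesis using deg[of v] that \<open>B \<subseteq> V\<close> by auto
  qed
  have 1: "2 * card ?F \<le> k * card B"
    using sum_bounded_above[of B "vertex_degree ?F" k] degF sum by (simp add: mult.commute)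
  have "vertex_degree ?F v \<le> card B - 1" if "v \<in> B" for v
    using vertex_degree_less_card[OF finB that, of ?F] F by fastforce
  then have 2: "2 * card ?F \<le> card B * (card B - 1)"
    using sum_bounded_above[of B "vertex_degree ?F" "card B - 1"] sum by simp
  have 3: "2 * card ?F < k * card B" if "odd (card B)"
  proof -
    have "B \<noteq> {}" using that by auto
    then obtain v where "v \<in> B" "vertex_degree ?F v < k"
      using reg degF by (auto simp: regular_graph_def le_less)
    then have "(\<Sum>v\<in>B. vertex_degree ?F v) < (\<Sum>v\<in>B. k)"
      using finB degF by (intro sum_strict_mono_ex1) auto
    then show ?thesis using sum by (simp add: mult.commute)
  qed
  \<comment> \<open>The arithmetic takes place in the integers to avoid truncated
    subtraction.\<close>
  have "(int k + 2) * int (card ?F)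
      \<le> ((int k)\<^sup>2 + int k + 2) * (int (card B) div 2) + (int k - 2) * int (card B)"
  proof (rule block_bound)
    show "2 * int (card ?F) \<le> int k * int (card B)" using 1 by (metis of_nat_mono of_nat_mult of_nat_numeral)
    show "2 * int (card ?F) \<le> int (card B) * (int (card B) - 1)"
    proof (cases "card B")
      case 0
      then show ?thesis using 1 by simp
    next
      case (Suc j)
      then have "2 * card ?F \<le> Suc j * j" using 2 by simp
      then have "int (2 * card ?F) \<le> int (Suc j * j)" by (rule of_nat_mono)
      then show ?thesis using Suc by (simp add: algebra_simps)
    qed
    show "2 * int (card ?F) < int k * int (card B)" if "odd (int (card B))"
      using 3 that by (metis even_of_nat of_nat_less_iff of_nat_mult of_nat_numeral)
  qed (use assms in auto)
  then have "int ((k + 2) * card ?F) \<le> int ((k\<^sup>2 + k + 2) * (card B div 2) + (k - 2) * card B)"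
    using \<open>k \<ge> 2\<close> by (simp add: zdiv_int of_nat_diff distrib_right)
  then show ?thesis by (simp only: of_nat_le_iff)
qed

section \<open>Summing over the cover\<close>

theorem theorem5:
  fixes V :: "'a set" and E :: "'a set set" and k n m :: nat
  assumes "k \<ge> 2" and "even k"
    and "simple_graph V E"
    and "card V = n" and "card E = m"
    and "max_degree V E \<le> k"
    and "\<And>C. C \<in> components V E \<Longrightarrow> \<not> regular_graph k C (induced_edges E C)"
  shows "real (matching_number E) \<ge>
    ((real k + 2) / (real k ^ 2 + real k + 2)) * real m
      - ((real k - 2) / (real k ^ 2 + real k + 2)) * real n"
proof -
  note G = \<open>simple_graph V E\<close>
  have finV: "finite V" using G by (simp add: simple_graph_def)
  have finE: "finite E" by (rule simple_graph_finite_edges[OF G])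
  have deg: "vertex_degree E u \<le> k" if "u \<in> V" for u
    using assms(6) finV that unfolding max_degree_def by (subst (asm) Max_le_iff) auto
  obtain M S P where M: "matching E M" and S: "S \<subseteq> V" and P: "\<Union>P \<subseteq> V - S" "disjoint P"
    and cover: "\<And>e. e \<in> E \<Longrightarrow> e \<inter> S \<noteq> {} \<or> (\<exists>B\<in>P. e \<subseteq> B)"
    and le: "card S + (\<Sum>B\<in>P. card B div 2) \<le> card M"
    using odd_set_cover[OF G] by metis
  have finS: "finite S" using S finV by (rule finite_subset)
  have "finite (\<Union>P)" using P finV by (meson finite_Diff finite_subset)
  then have finP: "finite P" and finB: "\<And>B. B \<in> P \<Longrightarrow> finite B"
    by (auto dest: finite_UnionD intro: finite_subset[OF Union_upper])
  define d where "d = k\<^sup>2 + k + 2"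
  have block: "(k + 2) * card (induced_edges E B) \<le> d * (card B div 2) + (k - 2) * card B"
    if "B \<in> P" for B
    unfolding d_def
  proof (rule induced_edges_bound[OF assms(1,2) G])
    show BV: "B \<subseteq> V" using that P by blast
    show "\<not> regular_graph k B (induced_edges E B)" if "B \<noteq> {}"
      using component_of_saturated_set[OF G _ BV deg] that assms(7) by blast
  qed (rule deg)
  have "E \<subseteq> (\<Union>v\<in>S. {e \<in> E. v \<in> e}) \<union> (\<Union>B\<in>P. induced_edges E B)"
    using cover by (fastforce simp: induced_edges_def)
  then have "m \<le> card ((\<Union>v\<in>S. {e \<in> E. v \<in> e}) \<union> (\<Union>B\<in>P. induced_edges E B))"
    unfolding \<open>card E = m\<close>[symmetric] using finE finS finP
    by (intro card_mono) (auto simp: induced_edges_def)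
  also have "\<dots> \<le> card (\<Union>v\<in>S. {e \<in> E. v \<in> e}) + card (\<Union>B\<in>P. induced_edges E B)"
    by (rule card_Un_le)
  also have "\<dots> \<le> (\<Sum>v\<in>S. card {e \<in> E. v \<in> e}) + (\<Sum>B\<in>P. card (induced_edges E B))"
    using finS finP by (intro add_mono card_UN_le)
  also have "(\<Sum>v\<in>S. card {e \<in> E. v \<in> e}) \<le> k * card S"
    using sum_bounded_above[of S "vertex_degree E" k] deg S
    by (auto simp: vertex_degree_def mult.commute)
  finally have "m \<le> k * card S + (\<Sum>B\<in>P. card (induced_edges E B))" by simp
  then have "(k + 2) * m \<le> (k + 2) * (k * card S + (\<Sum>B\<in>P. card (induced_edges E B)))"
    by (rule mult_le_mono2)
  also have "\<dots> = (k + 2) * k * card S + (\<Sum>B\<in>P. (k + 2) * card (induced_edges E B))"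
    by (simp add: algebra_simps sum_distrib_left sum.distrib)
  also have "\<dots> \<le> (k + 2) * k * card S + (\<Sum>B\<in>P. d * (card B div 2) + (k - 2) * card B)"
    by (intro add_left_mono sum_mono block)
  also have "\<dots> = d * (card S + (\<Sum>B\<in>P. card B div 2)) + (k - 2) * (card S + (\<Sum>B\<in>P. card B))"
  proof -
    \<comment> \<open>The charge of a vertex in \<open>S\<close> splits into \<open>d\<close>, paid
      by one matching edge, and \<open>k - 2\<close>, its own share of the term in
      \<open>n\<close>.\<close>
    have "(k + 2) * k = d + (k - 2)"
      using \<open>k \<ge> 2\<close> by (simp add: d_def algebra_simps power2_eq_square)
    then have "(k + 2) * k * card S = d * card S + (k - 2) * card S"
      by (simp add: add_mult_distrib)
    then show ?thesis by (simp add: sum.distrib sum_distrib_left add_mult_distrib2)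
  qed
  also have "\<dots> \<le> d * card M + (k - 2) * n"
  proof -
    \<comment> \<open>\<open>S\<close> and the blocks are pairwise disjoint subsets of
      \<open>V\<close>, so the shares of \<open>k - 2\<close> are counted at most \<open>n\<close>
      times.\<close>
    have "(\<Sum>B\<in>P. card B) = card (\<Union>P)"
      using P(2) finB by (intro card_Union_disjoint[symmetric]) (auto simp: disjoint_def pairwise_def disjnt_def)
    moreover have "card (S \<union> \<Union>P) = card S + card (\<Union>P)"
      using finS \<open>finite (\<Union>P)\<close> P(1) by (intro card_Un_disjoint) auto
    moreover have "card (S \<union> \<Union>P) \<le> n"
      unfolding \<open>card V = n\<close>[symmetric] using S P finV by (intro card_mono) auto
    ultimately show ?thesis using le by (intro add_mono mult_le_mono2) auto
  qed
  also have "\<dots> \<le> d * matching_number E + (k - 2) * n"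
    using matching_number_ge[OF G M] by simp
  finally have "real ((k + 2) * m) \<le> real (d * matching_number E + (k - 2) * n)"
    by (rule of_nat_mono)
  then have main: "(real k + 2) * real m \<le> real d * real (matching_number E) + (real k - 2) * real n"
    using \<open>k \<ge> 2\<close> by (simp add: of_nat_diff distrib_right)
  have d: "real k ^ 2 + real k + 2 = real d" by (simp add: d_def)
  have "real d > 0" by (simp add: d_def del: of_nat_add)
  then have "((real k + 2) * real m - (real k - 2) * real n) / real d \<le> real (matching_number E)"
    using main by (subst pos_divide_le_eq) (auto simp: mult.commute)
  then show ?thesis unfolding d by (simp add: diff_divide_distrib left_diff_distrib)
qed

end
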